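(* Let $I\subset\mathbb{R}$ be a closed interval, $f:I\to I$ a piecewise monotone map, and $D=\{x\in I: f(x)<x\}$. If $D$ has exactly $k$ connected components, then $f$ has a forbidden pattern of length at most $2k+2$.
   Context: A map $f:I\to I$ on a closed interval $I$ is piecewise monotone if there is a finite partition of $I$ into intervals on each of which $f$ is continuous and strictly monotone. For pairwise distinct reals $y_1,\dots,y_n$, the reduction $\rho(y_1,\dots,y_n)\in S_n$ is the permutation with the same relative order. For $x\in I$, $n\ge1$, $\mathrm{Pat}(x,f,n)=\rho(x,f(x),\dots,f^{n-1}(x))$, defined when these $n$ values are pairwise distinct. A permutation $\pi\in S_n$ is an allowed pattern of $f$ if $\pi=\mathrm{Pat}(x,f,n)$ for some $x\in I$, and a forbidden pattern otherwise. *)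

theory Defs
  imports "HOL-Analysis.Analysis" "HOL-Combinatorics.Permutations" "HOL-Library.Disjoint_Sets"
begin

definition piecewise_monotone_on :: "real set \<Rightarrow> (real \<Rightarrow> real) \<Rightarrow> bool" where
  "piecewise_monotone_on I f \<longleftrightarrow>
     (\<exists>P. finite P \<and> partition_on I P \<and>
        (\<forall>J\<in>P. is_interval J \<and> continuous_on J f \<and>
           (strict_mono_on J f \<or> strict_antimono_on J f)))"

text \<open>Elements of the symmetric group $S_n$ are functions with \<open>\<pi> permutes {1..n}\<close>, in one-line
  notation $\pi(1) \dots \pi(n)$. The sequence $y_1, \dots, y_n$ is given by the values of \<open>y\<close> on
  \<open>{1..n}\<close>; \<open>reduction n y\<close> is meaningful only if these are pairwise distinct.\<close>

definition reduction :: "nat \<Rightarrow> (nat \<Rightarrow> real) \<Rightarrow> nat \<Rightarrow> nat" where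
  "reduction n y =
     (THE \<pi>. \<pi> permutes {1..n} \<and> (\<forall>i\<in>{1..n}. \<forall>j\<in>{1..n}. \<pi> i < \<pi> j \<longleftrightarrow> y i < y j))"

lemma ex1_reduction:
  fixes y :: "nat \<Rightarrow> real"
  assumes "inj_on y {1..n}"
  shows "\<exists>!\<pi>. \<pi> permutes {1..n} \<and> (\<forall>i\<in>{1..n}. \<forall>j\<in>{1..n}. \<pi> i < \<pi> j \<longleftrightarrow> y i < y j)"
proof (rule ex_ex1I)
  define r where "r i = (if i \<in> {1..n} then card {j\<in>{1..n}. y j \<le> y i} else i)" for i :: nat
  have strict: "r i < r j" if "i \<in> {1..n}" "j \<in> {1..n}" "y i < y j" for i j
  proof -
    have "{l\<in>{1..n}. y l \<le> y i} \<subseteq> {l\<in>{1..n}. y l \<le> y j}"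
      using that(3) by auto
    moreover have "j \<in> {l\<in>{1..n}. y l \<le> y j}" "j \<notin> {l\<in>{1..n}. y l \<le> y i}"
      using that by auto
    ultimately have "{l\<in>{1..n}. y l \<le> y i} \<subset> {l\<in>{1..n}. y l \<le> y j}"
      by blast
    then have "card {l\<in>{1..n}. y l \<le> y i} < card {l\<in>{1..n}. y l \<le> y j}"
      by (intro psubset_card_mono) auto
    then show ?thesis
      using that by (simp add: r_def)
  qed
  have iff: "r i < r j \<longleftrightarrow> y i < y j" if "i \<in> {1..n}" "j \<in> {1..n}" for i j
  proof (cases "y i" "y j" rule: linorder_cases)
    case less
    with that show ?thesis using strict by auto
  next
    case equal
    with that assms have "i = j" by (auto dest: inj_onD)
    then show ?thesis by simp
  next
    case greater
    with that have "r j < r i" using strict by auto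
    with greater show ?thesis by simp
  qed
  have inj: "inj_on r {1..n}"
  proof (rule inj_onI)
    fix i j assume ij: "i \<in> {1..n}" "j \<in> {1..n}" "r i = r j"
    then have "y i = y j" using iff[of i j] iff[of j i] by simp
    with ij assms show "i = j" by (auto dest: inj_onD)
  qed
  have "r ` {1..n} \<subseteq> {1..n}"
  proof safe
    fix i assume i: "i \<in> {1..n}"
    have "card {i} \<le> card {j\<in>{1..n}. y j \<le> y i}" 
      using i by (intro card_mono) auto
    moreover have "card {j\<in>{1..n}. y j \<le> y i} \<le> card {1..n}"
      by (intro card_mono) auto
    ultimately show "r i \<in> {1..n}" using i by (auto simp: r_def)
  qed
  then have "bij_betw r {1..n} {1..n}"
    using inj by (simp add: bij_betw_def endo_inj_surj)
  then have "r permutes {1..n}"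
    by (rule bij_imp_permutes) (simp only: r_def if_False)
  with iff show "\<exists>\<pi>. \<pi> permutes {1..n} \<and> (\<forall>i\<in>{1..n}. \<forall>j\<in>{1..n}. \<pi> i < \<pi> j \<longleftrightarrow> y i < y j)"
    by blast
next
  fix p q :: "nat \<Rightarrow> nat"
  assume p: "p permutes {1..n} \<and> (\<forall>i\<in>{1..n}. \<forall>j\<in>{1..n}. p i < p j \<longleftrightarrow> y i < y j)"
    and q: "q permutes {1..n} \<and> (\<forall>i\<in>{1..n}. \<forall>j\<in>{1..n}. q i < q j \<longleftrightarrow> y i < y j)"
  have rank: "s i = card {j\<in>{1..n}. y j < y i} + 1"
    if s: "s permutes {1..n}" "\<forall>i\<in>{1..n}. \<forall>j\<in>{1..n}. s i < s j \<longleftrightarrow> y i < y j"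
      and i: "i \<in> {1..n}" for s i
  proof -
    have "s ` {j\<in>{1..n}. y j < y i} = {1..<s i}"
    proof (intro equalityI subsetI)
      fix m assume "m \<in> s ` {j\<in>{1..n}. y j < y i}"
      then show "m \<in> {1..<s i}"
        using s(2) i permutes_in_image[OF s(1)] by (auto simp: Suc_le_eq)
    next
      fix m assume m: "m \<in> {1..<s i}"
      have "s i \<in> {1..n}" using permutes_in_image[OF s(1)] i by blast
      with m have "m \<in> s ` {1..n}" using permutes_image[OF s(1)] by auto
      then obtain j where "j \<in> {1..n}" "m = s j" by blast
      with m s(2) i show "m \<in> s ` {j\<in>{1..n}. y j < y i}" by auto
    qed
    then have "card {1..<s i} = card {j\<in>{1..n}. y j < y i}"
      using card_image[OF permutes_inj_on[OF s(1)]] by metis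
    moreover have "s i \<ge> 1" using permutes_in_image[OF s(1), of i] i by simp
    ultimately show ?thesis by simp
  qed
  show "p = q"
  proof
    fix i show "p i = q i"
      using rank[of p i] rank[of q i] p q
      by (cases "i \<in> {1..n}") (auto simp: permutes_not_in)
  qed
qed

lemma
  assumes "inj_on y {1..n}"
  shows reduction_permutes: "reduction n y permutes {1..n}"
    and reduction_less_iff:
      "\<lbrakk>i \<in> {1..n}; j \<in> {1..n}\<rbrakk> \<Longrightarrow> reduction n y i < reduction n y j \<longleftrightarrow> y i < y j"
  using theI'[OF ex1_reduction[OF assms]] unfolding reduction_def by blast+

definition orbit_seq :: "real \<Rightarrow> (real \<Rightarrow> real) \<Rightarrow> nat \<Rightarrow> real" where
  "orbit_seq x f i = (f ^^ (i - 1)) x"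

definition Pat :: "real \<Rightarrow> (real \<Rightarrow> real) \<Rightarrow> nat \<Rightarrow> nat \<Rightarrow> nat" where
  "Pat x f n = reduction n (orbit_seq x f)"

text \<open>The condition \<open>inj_on (orbit_seq x f) {1..n}\<close> says that \<open>Pat x f n\<close> is defined.\<close>

definition allowed_pattern :: "real set \<Rightarrow> (real \<Rightarrow> real) \<Rightarrow> nat \<Rightarrow> (nat \<Rightarrow> nat) \<Rightarrow> bool" where
  "allowed_pattern I f n \<pi> \<longleftrightarrow>
     n \<ge> 1 \<and> \<pi> permutes {1..n} \<and> (\<exists>x\<in>I. inj_on (orbit_seq x f) {1..n} \<and> \<pi> = Pat x f n)"

definition forbidden_pattern :: "real set \<Rightarrow> (real \<Rightarrow> real) \<Rightarrow> nat \<Rightarrow> (nat \<Rightarrow> nat) \<Rightarrow> bool" where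
  "forbidden_pattern I f n \<pi> \<longleftrightarrow>
     n \<ge> 1 \<and> \<pi> permutes {1..n} \<and> \<not> allowed_pattern I f n \<pi>"

end

theory Submission
  imports Defs
begin

text \<open>
  Order the first \<open>2 * k + 1\<close> points of an orbit by size. If descents and ascents of the orbit
  alternate in this order, beginning and ending with a descent, then the \<open>k + 1\<close> descents lie in
  \<open>D\<close> and are separated by points outside \<open>D\<close>, which forces \<open>k + 1\<close> components. The pattern
  $3, 5, \dots, 2k+1, 2k+2, 2k, \dots, 4, 2, 1$ of length \<open>2 * k + 2\<close> has this property, so it is
  forbidden.
\<close>

text \<open>Connected subsets of the line are intervals: a component shared by \<open>a i\<close>
  and \<open>a j\<close> with \<open>i < j\<close> would contain \<open>b i\<close>, which lies
  between them.\<close>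

lemma card_components_ge_alternating:
  fixes S :: "real set" and a b :: "nat \<Rightarrow> real"
  assumes fin: "finite (components S)"
    and a: "\<And>j. j \<le> k \<Longrightarrow> a j \<in> S"
    and b: "\<And>j. j < k \<Longrightarrow> b j \<notin> S"
    and ab: "\<And>j. j < k \<Longrightarrow> a j < b j"
    and ba: "\<And>j. j < k \<Longrightarrow> b j < a (Suc j)"
  shows "k < card (components S)"
proof -
  let ?C = "\<lambda>j. connected_component_set S (a j)"
  have mono: "a i \<le> a j" if "i \<le> j" "j \<le> k" for i j
    using that
  proof (induction j rule: dec_induct)
    case (step m)
    then show ?case using ab[of m] ba[of m] by simp
  qed simp
  have distinct: "?C i \<noteq> ?C j" if "i < j" "j \<le> k" for i j
  proof
    assume eq: "?C i = ?C j"
    have "a i \<in> ?C i" "a j \<in> ?C j"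
      using a that by auto
    then have "a i \<in> ?C i" "a j \<in> ?C i"
      unfolding eq by blast+
    moreover have "a i < b i" "b i \<le> a j"
      using ab[of i] ba[of i] mono[of "Suc i" j] that by auto
    ultimately have "b i \<in> ?C i"
      using connectedD_interval[OF connected_connected_component, of "a i" S "a i" "a j" "b i"]
      by auto
    then show False
      using connected_component_subset b[of i] that by fastforce
  qed
  have "inj_on ?C {..k}"
    by (rule linorder_inj_onI) (use distinct in auto)
  then have "Suc k = card (?C ` {..k})"
    by (simp add: card_image)
  \<comment> \<open>Finiteness matters: an infinite set has \<open>card\<close> 0.\<close>
  also have "\<dots> \<le> card (components S)"
    using a by (intro card_mono fin) (auto simp: components_def)
  finally show ?thesis by simp
qed

lemma orbit_seq_Suc: "i \<ge> 1 \<Longrightarrow> orbit_seq x f (Suc i) = f (orbit_seq x f i)"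
  by (cases i) (auto simp: orbit_seq_def)

lemma orbit_seq_in:
  assumes "f ` I \<subseteq> I" "x \<in> I"
  shows "orbit_seq x f i \<in> I"
proof -
  have "(f ^^ m) x \<in> I" for m
    using assms by (induction m) auto
  then show ?thesis by (simp add: orbit_seq_def)
qed

theorem theorem4p2:
  fixes I :: "real set" and f :: "real \<Rightarrow> real" and k :: nat
  assumes "is_interval I" and "closed I"
    and "f ` I \<subseteq> I"
    and "piecewise_monotone_on I f"
    and "finite (components {x \<in> I. f x < x})"
    and "card (components {x \<in> I. f x < x}) = k"
  shows "\<exists>n \<pi>. n \<le> 2 * k + 2 \<and> forbidden_pattern I f n \<pi>"
proof -
  define n where "n = 2 * k + 2"
  \<comment> \<open>The last entry is 0 rather than 1; this does not change the reduction.\<close>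
  define w :: "nat \<Rightarrow> real" where "w i = real (if i \<le> k then 2 * i + 1 else 2 * (n - i))" for i
  have "inj_on w {1..n}"
    \<comment> \<open>The two branches of \<open>w\<close> are injective on \<open>{1..n}\<close>
      and differ in parity.\<close>
    unfolding w_def by (rule inj_onI) (auto split: if_splits, presburger+)
  note perm = reduction_permutes[OF this] and less_w = reduction_less_iff[OF this]
  have "\<not> allowed_pattern I f n (reduction n w)"
  proof
    assume "allowed_pattern I f n (reduction n w)"
    then obtain x where x: "x \<in> I" and inj: "inj_on (orbit_seq x f) {1..n}"
      and eq: "reduction n w = reduction n (orbit_seq x f)"
      unfolding allowed_pattern_def Pat_def by blast
    let ?y = "orbit_seq x f"
    have less: "?y i < ?y j" if "w i < w j" "1 \<le> i" "i \<le> n" "1 \<le> j" "j \<le> n" for i j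
      using less_w[of i j] reduction_less_iff[OF inj, of i j] that by (simp add: eq)
    have "k < card (components {x \<in> I. f x < x})"
    \<comment> \<open>The even values 2, 4, ..., 2k+2 of \<open>w\<close> sit at positions n-1 down
      to k+1; the odd values 3, ..., 2k+1 between them sit at positions 1 to k.\<close>
    proof (rule card_components_ge_alternating[where a = "\<lambda>j. ?y (n - Suc j)" and b = "\<lambda>j. ?y (Suc j)"])
      fix j assume "j \<le> k"
      \<comment> \<open>For \<open>j = 0\<close> the successor is the final entry, which makes
        position n-1 a descent.\<close>
      then have "?y (Suc (n - Suc j)) < ?y (n - Suc j)"
        by (intro less) (auto simp: w_def n_def)
      moreover have "?y (Suc (n - Suc j)) = f (?y (n - Suc j))"
        using \<open>j \<le> k\<close> by (intro orbit_seq_Suc) (auto simp: n_def)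
      ultimately show "?y (n - Suc j) \<in> {x \<in> I. f x < x}"
        using orbit_seq_in[OF assms(3) x] by simp
    next
      fix j assume j: "j < k"
      \<comment> \<open>For \<open>j = k - 1\<close> the successor is the peak 2k+2, still above
        2k+1.\<close>
      have "?y (Suc j) < ?y (Suc (Suc j))"
        using j by (intro less) (auto simp: w_def n_def)
      then show "?y (Suc j) \<notin> {x \<in> I. f x < x}"
        by (simp add: orbit_seq_Suc)
      show "?y (n - Suc j) < ?y (Suc j)" "?y (Suc j) < ?y (n - Suc (Suc j))"
        using j by (intro less; auto simp: w_def n_def)+
    qed (fact assms(5))
    with assms(6) show False by simp
  qed
  with perm have "forbidden_pattern I f n (reduction n w)"
    by (simp add: forbidden_pattern_def n_def)
  then show ?thesis
    unfolding n_def by blast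
qed

end
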